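(* Let $W$ be a finite group and $V$ a finite-dimensional irreducible linear representation of $W$ over $\mathbb{R}$ or $\mathbb{C}$. Suppose there exist $v\in V\setminus\{0\}$ and $v'\in Wv$ such that $Wv\setminus\{v,v'\}$ does not span $V$. Then $|Wv|\le 2\dim(V)$.
   Context: $Wv$ denotes the orbit of $v$ under $W$. *)

theory Defs
  imports "HOL-Analysis.Analysis" "HOL-Algebra.Group"
begin

text \<open>A linear representation of the group G on the K-vector space K^n
  (vectors indexed by the finite type 'n), K any field.\<close>
definition lin_rep :: "('g, 'b) monoid_scheme \<Rightarrow> ('g \<Rightarrow> ('k::field)^'n \<Rightarrow> 'k^'n) \<Rightarrow> bool" where
  "lin_rep G \<rho> \<longleftrightarrow>
     (\<forall>g \<in> carrier G. Vector_Spaces.linear (*s) (*s) (\<rho> g)) \<and>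
     (\<forall>g \<in> carrier G. \<forall>h \<in> carrier G. \<rho> (g \<otimes>\<^bsub>G\<^esub> h) = \<rho> g \<circ> \<rho> h) \<and>
     \<rho> \<one>\<^bsub>G\<^esub> = id"

text \<open>Irreducible: the space is nonzero and has no W-invariant subspaces other than 0 and itself.\<close>
definition irreducible_rep :: "('g, 'b) monoid_scheme \<Rightarrow> ('g \<Rightarrow> ('k::field)^'n \<Rightarrow> 'k^'n) \<Rightarrow> bool" where
  "irreducible_rep G \<rho> \<longleftrightarrow>
     lin_rep G \<rho> \<and> (UNIV :: ('k^'n) set) \<noteq> {0} \<and>
     (\<forall>U. vec.subspace U \<and> (\<forall>g \<in> carrier G. \<rho> g ` U \<subseteq> U) \<longrightarrow> U = {0} \<or> U = UNIV)"

definition rep_orbit :: "('g, 'b) monoid_scheme \<Rightarrow> ('g \<Rightarrow> 'v \<Rightarrow> 'v) \<Rightarrow> 'v \<Rightarrow> 'v set" where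
  "rep_orbit G \<rho> v = (\<lambda>g. \<rho> g v) ` carrier G"

end

theory Submission
  imports Defs
begin

text \<open>Let \<open>U\<close> be the span of \<open>Wv - {v, v'}\<close>. The intersection of the translates \<open>gU\<close>
  is \<open>W\<close>-invariant and lies in \<open>U \<noteq> V\<close>, so by irreducibility it is \<open>0\<close>; since each proper
  intersection step lowers the dimension, at most \<open>dim V\<close> translates \<open>g\<^sub>1U, \<dots>, g\<^sub>kU\<close> already
  intersect in \<open>0\<close>. Every \<open>w \<in> Wv\<close> is nonzero, so it avoids some \<open>g\<^sub>iU\<close>; writing \<open>w = g\<^sub>iu\<close>
  with \<open>u \<in> Wv\<close> forces \<open>u \<in> {v, v'}\<close>. Hence \<open>Wv \<subseteq> {g\<^sub>iv, g\<^sub>iv'}\<close> and \<open>|Wv| \<le> 2k \<le> 2 dim V\<close>.\<close>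

lemma subfamily_same_Inter_card_le_dim:
  fixes X :: "'i \<Rightarrow> ('k::field^'n) set"
  assumes "finite I" "\<And>i. i \<in> I \<Longrightarrow> vec.subspace (X i)"
  shows "\<exists>J\<subseteq>I. card J + vec.dim (\<Inter>i\<in>I. X i) \<le> vec.dim (UNIV :: ('k^'n) set)
                \<and> (\<Inter>i\<in>J. X i) = (\<Inter>i\<in>I. X i)"
  using assms
proof (induction I rule: finite_induct)
  case empty
  then show ?case by auto
next
  case (insert i I)
  then obtain J where J: "J \<subseteq> I" "card J + vec.dim (\<Inter>j\<in>I. X j) \<le> vec.dim (UNIV :: ('k^'n) set)"
      "(\<Inter>j\<in>J. X j) = (\<Inter>j\<in>I. X j)"
    by auto
  show ?case
  proof (cases "(\<Inter>j\<in>I. X j) \<subseteq> X i")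
    case True
    then have "(\<Inter>j\<in>insert i I. X j) = (\<Inter>j\<in>I. X j)" by auto
    then show ?thesis using J by (intro exI[of _ J]) auto
  next
    case False
    have "vec.subspace (X i)" "vec.subspace (\<Inter>j\<in>I. X j)"
      using insert by (auto intro: vec.subspace_Inter)
    moreover have "X i \<inter> (\<Inter>j\<in>I. X j) \<subset> (\<Inter>j\<in>I. X j)" using False by auto
    ultimately have "vec.dim (X i \<inter> (\<Inter>j\<in>I. X j)) < vec.dim (\<Inter>j\<in>I. X j)"
      by (intro vec.dim_psubset) (simp add: vec.span_eq_iff[THEN iffD2] vec.subspace_inter)
    moreover have "card (insert i J) \<le> card J + 1"
      using J(1) insert(1) by (simp add: card_insert_if finite_subset)
    ultimately show ?thesis using J by (intro exI[of _ "insert i J"]) auto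
  qed
qed

lemma lin_rep_apply_mult:
  assumes "lin_rep G \<rho>" "g \<in> carrier G" "h \<in> carrier G"
  shows "\<rho> g (\<rho> h x) = \<rho> (g \<otimes>\<^bsub>G\<^esub> h) x"
  using assms unfolding lin_rep_def by simp

lemma lin_rep_inv_apply:
  assumes "group G" "lin_rep G \<rho>" "g \<in> carrier G"
  shows "\<rho> (inv\<^bsub>G\<^esub> g) (\<rho> g x) = x"
  using assms by (simp add: lin_rep_apply_mult group.l_inv group.inv_closed)
    (simp add: lin_rep_def)

lemma rep_orbit_nonzero:
  assumes "group G" "lin_rep G \<rho>" "v \<noteq> 0" "w \<in> rep_orbit G \<rho> v"
  shows "w \<noteq> 0"
proof
  assume "w = 0"
  obtain g where g: "g \<in> carrier G" "w = \<rho> g v" using assms(4) unfolding rep_orbit_def by auto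
  have "Vector_Spaces.linear (*s) (*s) (\<rho> (inv\<^bsub>G\<^esub> g))"
    using assms(1,2) g(1) unfolding lin_rep_def by (simp add: group.inv_closed)
  then have "\<rho> (inv\<^bsub>G\<^esub> g) w = 0" using \<open>w = 0\<close> by (simp add: vec.linear_0)
  then show False using lin_rep_inv_apply[OF assms(1,2) g(1)] g(2) assms(3) by simp
qed

lemma rep_orbit_translate:
  assumes "group G" "lin_rep G \<rho>" "g \<in> carrier G" "w \<in> rep_orbit G \<rho> v"
  obtains u where "u \<in> rep_orbit G \<rho> v" "w = \<rho> g u"
proof -
  interpret group G by fact
  obtain h where h: "h \<in> carrier G" "w = \<rho> h v" using assms(4) unfolding rep_orbit_def by auto
  have "h = g \<otimes>\<^bsub>G\<^esub> (inv\<^bsub>G\<^esub> g \<otimes>\<^bsub>G\<^esub> h)" using assms(3) h(1) by (simp add: m_assoc[symmetric])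
  then have "w = \<rho> g (\<rho> (inv\<^bsub>G\<^esub> g \<otimes>\<^bsub>G\<^esub> h) v)"
    using assms(2,3) h by (simp add: lin_rep_apply_mult)
  moreover have "\<rho> (inv\<^bsub>G\<^esub> g \<otimes>\<^bsub>G\<^esub> h) v \<in> rep_orbit G \<rho> v"
    using assms(3) h(1) unfolding rep_orbit_def by simp
  ultimately show thesis using that by blast
qed

lemma Inter_translates_invariant:
  assumes "group G" "lin_rep G \<rho>" "g \<in> carrier G"
  shows "\<rho> g ` (\<Inter>h\<in>carrier G. \<rho> h ` U) \<subseteq> (\<Inter>h\<in>carrier G. \<rho> h ` U)"
proof (intro subsetI INT_I)
  interpret group G by fact
  fix y h assume "y \<in> \<rho> g ` (\<Inter>h\<in>carrier G. \<rho> h ` U)" and h: "h \<in> carrier G"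
  then obtain x where x: "\<forall>k\<in>carrier G. x \<in> \<rho> k ` U" and y: "y = \<rho> g x" by blast
  have "x \<in> \<rho> (inv\<^bsub>G\<^esub> g \<otimes>\<^bsub>G\<^esub> h) ` U" using x h assms(3) by simp
  then obtain u where "u \<in> U" "x = \<rho> (inv\<^bsub>G\<^esub> g \<otimes>\<^bsub>G\<^esub> h) u" by blast
  moreover have "g \<otimes>\<^bsub>G\<^esub> (inv\<^bsub>G\<^esub> g \<otimes>\<^bsub>G\<^esub> h) = h" using assms(3) h by (simp add: m_assoc[symmetric])
  ultimately show "y \<in> \<rho> h ` U"
    using assms(2,3) h y by (simp add: lin_rep_apply_mult)
qed

lemma Inter_translates_proper_subspace_eq_0:
  assumes "group G" "irreducible_rep G \<rho>" "vec.subspace U" "U \<noteq> UNIV"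
  shows "(\<Inter>h\<in>carrier G. \<rho> h ` U) = {0}"
proof -
  have rep: "lin_rep G \<rho>" using assms(2) unfolding irreducible_rep_def by simp
  have "vec.subspace (\<rho> h ` U)" if "h \<in> carrier G" for h
    using rep that assms(3) unfolding lin_rep_def by (simp add: vec.linear_subspace_image)
  then have "vec.subspace (\<Inter>h\<in>carrier G. \<rho> h ` U)" by (simp add: vec.subspace_Inter)
  moreover have "(\<Inter>h\<in>carrier G. \<rho> h ` U) \<subseteq> \<rho> \<one>\<^bsub>G\<^esub> ` U"
    using group.is_monoid[OF assms(1)] by (intro INT_lower monoid.one_closed)
  then have "(\<Inter>h\<in>carrier G. \<rho> h ` U) \<noteq> UNIV"
    using rep assms(4) unfolding lin_rep_def by auto
  moreover have "\<forall>g\<in>carrier G. \<rho> g ` (\<Inter>h\<in>carrier G. \<rho> h ` U) \<subseteq> (\<Inter>h\<in>carrier G. \<rho> h ` U)"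
    using Inter_translates_invariant[OF assms(1) rep] by blast
  ultimately show ?thesis using assms(2) unfolding irreducible_rep_def by blast
qed

lemma card_rep_orbit_le_cover:
  assumes "group G" "lin_rep G \<rho>" "v \<noteq> 0" "finite S" "S \<subseteq> carrier G"
    and "(\<Inter>g\<in>S. \<rho> g ` vec.span (rep_orbit G \<rho> v - {v, v'})) = {0}"
  shows "card (rep_orbit G \<rho> v) \<le> 2 * card S"
proof -
  have "rep_orbit G \<rho> v \<subseteq> (\<lambda>g. \<rho> g v) ` S \<union> (\<lambda>g. \<rho> g v') ` S"
  proof
    fix w assume w: "w \<in> rep_orbit G \<rho> v"
    have "w \<noteq> 0" using rep_orbit_nonzero[OF assms(1-3) w] .
    then obtain g where g: "g \<in> S" "w \<notin> \<rho> g ` vec.span (rep_orbit G \<rho> v - {v, v'})"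
      using assms(6) by blast
    obtain u where u: "u \<in> rep_orbit G \<rho> v" "w = \<rho> g u"
      using rep_orbit_translate[OF assms(1,2) _ w] g(1) assms(5) by blast
    have "u \<in> {v, v'}"
      using u g(2) vec.span_base[of u "rep_orbit G \<rho> v - {v, v'}"] by blast
    then show "w \<in> (\<lambda>g. \<rho> g v) ` S \<union> (\<lambda>g. \<rho> g v') ` S" using u(2) g(1) by auto
  qed
  then have "card (rep_orbit G \<rho> v) \<le> card ((\<lambda>g. \<rho> g v) ` S \<union> (\<lambda>g. \<rho> g v') ` S)"
    using assms(4) by (intro card_mono) auto
  also have "\<dots> \<le> card S + card S"
    using assms(4) by (intro card_Un_le[THEN order_trans] add_mono card_image_le)
  finally show ?thesis by simp
qed

lemma card_rep_orbit_le_twice_dim: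
  fixes \<rho> :: "'g \<Rightarrow> 'k::field^'n \<Rightarrow> 'k^'n"
  assumes "group G" "finite (carrier G)" "irreducible_rep G \<rho>" "v \<noteq> 0"
    and "vec.span (rep_orbit G \<rho> v - {v, v'}) \<noteq> UNIV"
  shows "card (rep_orbit G \<rho> v) \<le> 2 * vec.dim (UNIV :: ('k^'n) set)"
proof -
  define U where "U = vec.span (rep_orbit G \<rho> v - {v, v'})"
  have rep: "lin_rep G \<rho>" using assms(3) unfolding irreducible_rep_def by simp
  have Inter_0: "(\<Inter>h\<in>carrier G. \<rho> h ` U) = {0}"
    using assms(1,3,5) by (simp add: U_def Inter_translates_proper_subspace_eq_0)
  have translate_subspace: "vec.subspace (\<rho> h ` U)" if "h \<in> carrier G" for h
    using rep that unfolding lin_rep_def U_def by (simp add: vec.linear_subspace_image)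
  obtain S where S: "S \<subseteq> carrier G"
      "card S + vec.dim (\<Inter>h\<in>carrier G. \<rho> h ` U) \<le> vec.dim (UNIV :: ('k^'n) set)"
      "(\<Inter>h\<in>S. \<rho> h ` U) = (\<Inter>h\<in>carrier G. \<rho> h ` U)"
    using subfamily_same_Inter_card_le_dim[where X = "\<lambda>h. \<rho> h ` U", OF assms(2) translate_subspace]
    by blast
  have "card (rep_orbit G \<rho> v) \<le> 2 * card S"
    using assms(1) rep assms(4) finite_subset[OF S(1) assms(2)] S(1)
    by (rule card_rep_orbit_le_cover) (use S(3) Inter_0 in \<open>simp add: U_def\<close>)
  with S(2) Inter_0 show ?thesis by simp
qed

theorem lemma4p4:
  fixes G :: "('g, 'b) monoid_scheme" and \<rho> :: "'g \<Rightarrow> real^'n \<Rightarrow> real^'n"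
    and H :: "('h, 'c) monoid_scheme" and \<sigma> :: "'h \<Rightarrow> complex^'m \<Rightarrow> complex^'m"
  shows "(\<forall>v v'. group G \<and> finite (carrier G) \<and> irreducible_rep G \<rho> \<and>
              v \<noteq> 0 \<and> v' \<in> rep_orbit G \<rho> v \<and>
              vec.span (rep_orbit G \<rho> v - {v, v'}) \<noteq> UNIV
            \<longrightarrow> card (rep_orbit G \<rho> v) \<le> 2 * vec.dim (UNIV :: (real^'n) set))
       \<and> (\<forall>v v'. group H \<and> finite (carrier H) \<and> irreducible_rep H \<sigma> \<and>
              v \<noteq> 0 \<and> v' \<in> rep_orbit H \<sigma> v \<and>
              vec.span (rep_orbit H \<sigma> v - {v, v'}) \<noteq> UNIV
            \<longrightarrow> card (rep_orbit H \<sigma> v) \<le> 2 * vec.dim (UNIV :: (complex^'m) set))"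
  by (blast intro: card_rep_orbit_le_twice_dim)

end
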